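(* Let $E$ and $F$ be Banach spaces over $\mathbb{K}$, $P\in\mathcal{P}(^{2}E;F)$ and $1\le q\le p<\infty$. Then either $S_{p;q}(P)=\emptyset$ or $S_{p;q}(P)=\{a\in E:\hat dP(a)\text{ is }(p;q)\text{-summing}\}$. So, $S_{p;q}(P)$ is either empty or a linear subspace of $E$. In particular, if $P\in\mathcal{P}(^{2}E)$, then either $S_{p;q}(P)=\emptyset$ or $S_{p;q}(P)=E$.
   Context: $\mathbb{K}=\mathbb{R}$ or $\mathbb{C}$. $\mathcal{P}(^{n}E;F)$ is the space of continuous $n$-homogeneous polynomials from $E$ to $F$, and $\mathcal{P}(^{n}E)=\mathcal{P}(^{n}E;\mathbb{K})$. For $P\in\mathcal{P}(^{2}E;F)$, $\check P$ denotes the symmetric bilinear mapping with $P(x)=\check P(x,x)$, and for $a\in E$, $\hat dP(a)\colon E\to F$ is the continuous linear operator $\hat dP(a)(x)=2\check P(a,x)$. $\ell_p(F)$ is the space of sequences $(y_j)_{j=1}^\infty$ in $F$ with $\sum_j\|y_j\|^p<\infty$. $\ell_q^{w}(E)$ is the space of sequences $(x_j)_{j=1}^\infty$ in $E$ with $(\varphi(x_j))_j\in\ell_q$ for all $\varphi\in E'$ (the dual of $E$), normed by $\|(x_j)_j\|_{w,q}=\sup\{(\sum_j|\varphi(x_j)|^q)^{1/q}:\varphi\in E',\|\varphi\|\le1\}$. $\ell_q^{u}(E)$ (unconditionally $q$-summable sequences) is the subspace of those $(x_j)_j\in\ell_q^w(E)$ with $\lim_{k\to\infty}\|(x_j)_{j=k}^\infty\|_{w,q}=0$.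 For $1\le q\le p<\infty$, a mapping $f\colon E\to F$ is $(p;q)$-summing at $a\in E$ if $(f(a+x_j)-f(a))_{j=1}^\infty\in\ell_p(F)$ whenever $(x_j)_{j=1}^\infty\in\ell_q^u(E)$. The $(p;q)$-summing set of $f$ is $S_{p;q}(f)=\{a\in E: f\text{ is }(p;q)\text{-summing at }a\}$. A continuous linear operator $u\colon E\to F$ is $(p;q)$-summing if $(u(x_j))_j\in\ell_p(F)$ whenever $(x_j)_j\in\ell_q^w(E)$ (classical definition). *)

theory Defs
  imports "HOL-Analysis.Analysis"
begin

text \<open>
  The scalar field is the real or the complex field: the axiom says that the type consists of the
  multiples of \<open>1\<close>, or that it is spanned over the reals by \<open>1\<close> and a square root \<open>i\<close> of \<open>-1\<close> and
  carries the usual modulus.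
\<close>

class real_or_complex = real_normed_field + banach +
  assumes real_or_complex:
    "(\<forall>x. \<exists>a. x = a *\<^sub>R 1) \<or>
     (\<exists>i. i * i = - 1 \<and>
        (\<forall>x. \<exists>a b. x = a *\<^sub>R 1 + b *\<^sub>R i \<and> norm x = sqrt (a\<^sup>2 + b\<^sup>2)))"

instance real :: real_or_complex
  by standard simp

instance complex :: real_or_complex
proof
  have "x = Re x *\<^sub>R 1 + Im x *\<^sub>R \<i> \<and> norm x = sqrt ((Re x)\<^sup>2 + (Im x)\<^sup>2)" for x
    by (simp add: complex_eq_iff cmod_def)
  then show "(\<forall>x::complex. \<exists>a. x = a *\<^sub>R 1) \<or>
     (\<exists>i::complex. i * i = - 1 \<and>
        (\<forall>x. \<exists>a b. x = a *\<^sub>R 1 + b *\<^sub>R i \<and> norm x = sqrt (a\<^sup>2 + b\<^sup>2)))"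
    using i_squared by blast
qed

text \<open>
  The library's class \<^class>\<open>banach\<close> describes real Banach spaces. A Banach space over the scalar
  field \<open>'k\<close> is such a type with a scalar multiplication by \<open>'k\<close> that extends the real one.
\<close>

locale banach_space_over = vector_space scale
  for scale :: "'k::real_or_complex \<Rightarrow> 'a::banach \<Rightarrow> 'a" +
  assumes scale_of_real: "scale (of_real r) x = r *\<^sub>R x"
    and norm_scale: "norm (scale c x) = norm c * norm x"

lemma banach_space_over_scaleR:
  "banach_space_over (scaleR :: real \<Rightarrow> 'a::banach \<Rightarrow> 'a)"
  by unfold_locales (auto simp: algebra_simps)

lemma banach_space_over_times:
  "banach_space_over (times :: 'k::real_or_complex \<Rightarrow> 'k \<Rightarrow> 'k)"
  by unfold_locales (auto simp: algebra_simps scaleR_conv_of_real norm_mult)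

definition continuous_linear ::
  "('k::real_or_complex \<Rightarrow> 'e::banach \<Rightarrow> 'e) \<Rightarrow> ('k \<Rightarrow> 'f::banach \<Rightarrow> 'f) \<Rightarrow> ('e \<Rightarrow> 'f) \<Rightarrow> bool" where
  "continuous_linear sE sF u \<longleftrightarrow> Vector_Spaces.linear sE sF u \<and> continuous_on UNIV u"

definition dual :: "('k::real_or_complex \<Rightarrow> 'e::banach \<Rightarrow> 'e) \<Rightarrow> ('e \<Rightarrow> 'k) set" where
  "dual sE = {\<phi>. continuous_linear sE times \<phi>}"

definition bilinear_over ::
  "('k::real_or_complex \<Rightarrow> 'e::banach \<Rightarrow> 'e) \<Rightarrow> ('k \<Rightarrow> 'f::banach \<Rightarrow> 'f)
    \<Rightarrow> ('e \<Rightarrow> 'e \<Rightarrow> 'f) \<Rightarrow> bool" where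
  "bilinear_over sE sF A \<longleftrightarrow>
     (\<forall>x. Vector_Spaces.linear sE sF (\<lambda>y. A x y)) \<and>
     (\<forall>y. Vector_Spaces.linear sE sF (\<lambda>x. A x y))"

definition poly2 ::
  "('k::real_or_complex \<Rightarrow> 'e::banach \<Rightarrow> 'e) \<Rightarrow> ('k \<Rightarrow> 'f::banach \<Rightarrow> 'f) \<Rightarrow> ('e \<Rightarrow> 'f) set" where
  "poly2 sE sF =
     {P. \<exists>A. bilinear_over sE sF A \<and> continuous_on UNIV (\<lambda>(x, y). A x y) \<and> (\<forall>x. P x = A x x)}"

definition polar ::
  "('k::real_or_complex \<Rightarrow> 'e::banach \<Rightarrow> 'e) \<Rightarrow> ('k \<Rightarrow> 'f::banach \<Rightarrow> 'f)
    \<Rightarrow> ('e \<Rightarrow> 'f) \<Rightarrow> 'e \<Rightarrow> 'e \<Rightarrow> 'f" where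
  "polar sE sF P =
     (THE A. bilinear_over sE sF A \<and> (\<forall>x y. A x y = A y x) \<and> (\<forall>x. P x = A x x))"

text \<open>The definite description is justified by polarization.\<close>

lemma polar_ex1:
  assumes P: "P \<in> poly2 sE sF"
  shows "\<exists>!A. bilinear_over sE sF A \<and> (\<forall>x y. A x y = A y x) \<and> (\<forall>x. P x = A x x)"
proof -
  obtain A where A: "bilinear_over sE sF A" "\<And>x. P x = A x x"
    using P unfolding poly2_def by auto
  have lin: "Vector_Spaces.linear sE sF (\<lambda>y. A x y)" "Vector_Spaces.linear sE sF (\<lambda>y. A y x)" for x
    using A(1) unfolding bilinear_over_def by auto
  interpret F: vector_space sF
    using lin(1)[of 0] by (simp add: Vector_Spaces.linear_def)
  interpret VP: vector_space_pair sE sF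
    using lin(1)[of 0] by (simp add: Vector_Spaces.linear_def vector_space_pair_def)
  define B where "B x y = sF (1/2) (A x y + A y x)" for x y
  have "Vector_Spaces.linear sE sF (\<lambda>y. A x y + A y x)"
    "Vector_Spaces.linear sE sF (\<lambda>y. A y x + A x y)" for x
    using VP.linear_compose_add[OF lin(1) lin(2)] VP.linear_compose_add[OF lin(2) lin(1)]
    by blast+
  then have "bilinear_over sE sF B"
    unfolding bilinear_over_def B_def by (auto intro: VP.linear_compose_scale_right)
  moreover have "B x y = B y x" for x y
    by (simp add: B_def add.commute)
  moreover have "P x = B x x" for x
  proof -
    have "B x x = sF (1/2 + 1/2) (A x x)"
      unfolding B_def by (simp only: F.scale_right_distrib F.scale_left_distrib)
    then show ?thesis using A(2) by simp
  qed
  moreover have "C = B"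
    if C: "bilinear_over sE sF C" "\<And>x y. C x y = C y x" "\<And>x. P x = C x x"
      and B: "bilinear_over sE sF B" "\<And>x y. B x y = B y x" "\<And>x. P x = B x x" for B C
  proof (intro ext)
    fix x y
    have *: "sF 2 (D x y) = P (x + y) - P x - P y"
      if D: "bilinear_over sE sF D" "\<And>x y. D x y = D y x" "\<And>x. P x = D x x" for D
    proof -
      have l: "Vector_Spaces.linear sE sF (\<lambda>y. D x y)" "Vector_Spaces.linear sE sF (\<lambda>y. D y x)" for x
        using D(1) unfolding bilinear_over_def by auto
      have "D (x + y) (x + y) = D x x + D y x + (D x y + D y y)"
        using VP.linear_add[OF l(1)] VP.linear_add[OF l(2)] by simp
      moreover have "sF 2 (D x y) = D x y + D x y"
        using F.scale_left_distrib[of 1 1 "D x y"] by simp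
      ultimately show ?thesis
        using D(2)[of y x] D(3) by (simp add: algebra_simps)
    qed
    have "sF 2 (C x y) = sF 2 (B x y)"
      using *[OF C] *[OF B] by simp
    then show "C x y = B x y"
      by (simp add: F.scale_left_imp_eq)
  qed
  ultimately show ?thesis
    by (intro ex1I[of _ B]) auto
qed

definition dhat ::
  "('k::real_or_complex \<Rightarrow> 'e::banach \<Rightarrow> 'e) \<Rightarrow> ('k \<Rightarrow> 'f::banach \<Rightarrow> 'f)
    \<Rightarrow> ('e \<Rightarrow> 'f) \<Rightarrow> 'e \<Rightarrow> 'e \<Rightarrow> 'f" where
  "dhat sE sF P a = (\<lambda>x. sF 2 (polar sE sF P a x))"

text \<open>Sequences are indexed from \<open>0\<close>.\<close>

definition ell :: "real \<Rightarrow> (nat \<Rightarrow> 'f::banach) set" where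
  "ell p = {y. summable (\<lambda>j. norm (y j) powr p)}"

definition ell_w :: "('k::real_or_complex \<Rightarrow> 'e::banach \<Rightarrow> 'e) \<Rightarrow> real \<Rightarrow> (nat \<Rightarrow> 'e) set" where
  "ell_w sE q = {x. \<forall>\<phi>\<in>dual sE. (\<lambda>j. \<phi> (x j)) \<in> ell q}"

text \<open>
  The supremum is meaningful for members of \<^const>\<open>ell_w\<close>: there every series converges, and the
  set is bounded above by the uniform boundedness principle.
\<close>

definition norm_w :: "('k::real_or_complex \<Rightarrow> 'e::banach \<Rightarrow> 'e) \<Rightarrow> real \<Rightarrow> (nat \<Rightarrow> 'e) \<Rightarrow> real" where
  "norm_w sE q x =
     (SUP \<phi>\<in>{\<phi>\<in>dual sE. onorm \<phi> \<le> 1}. (\<Sum>j. norm (\<phi> (x j)) powr q) powr (1 / q))"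

definition ell_u :: "('k::real_or_complex \<Rightarrow> 'e::banach \<Rightarrow> 'e) \<Rightarrow> real \<Rightarrow> (nat \<Rightarrow> 'e) set" where
  "ell_u sE q = {x\<in>ell_w sE q. (\<lambda>k. norm_w sE q (\<lambda>j. x (k + j))) \<longlonglongrightarrow> 0}"

definition summing_at ::
  "('k::real_or_complex \<Rightarrow> 'e::banach \<Rightarrow> 'e) \<Rightarrow> real \<Rightarrow> real \<Rightarrow> ('e \<Rightarrow> 'f::banach) \<Rightarrow> 'e \<Rightarrow> bool" where
  "summing_at sE p q f a \<longleftrightarrow> (\<forall>x\<in>ell_u sE q. (\<lambda>j. f (a + x j) - f a) \<in> ell p)"

definition summing_set ::
  "('k::real_or_complex \<Rightarrow> 'e::banach \<Rightarrow> 'e) \<Rightarrow> real \<Rightarrow> real \<Rightarrow> ('e \<Rightarrow> 'f::banach) \<Rightarrow> 'e set" where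
  "summing_set sE p q f = {a. summing_at sE p q f a}"

definition summing_operator ::
  "('k::real_or_complex \<Rightarrow> 'e::banach \<Rightarrow> 'e) \<Rightarrow> ('k \<Rightarrow> 'f::banach \<Rightarrow> 'f)
    \<Rightarrow> real \<Rightarrow> real \<Rightarrow> ('e \<Rightarrow> 'f) \<Rightarrow> bool" where
  "summing_operator sE sF p q u \<longleftrightarrow>
     continuous_linear sE sF u \<and> (\<forall>x\<in>ell_w sE q. (\<lambda>j. u (x j)) \<in> ell p)"

end

theory Submission
  imports Defs
begin

text \<open>
  For a symmetric bilinear map inducing \<open>P\<close> one has
  \<open>P (a + x) - P a = dhat a x + P x\<close>, where the first term is odd and the second is even
  in \<open>x\<close>. The unconditionally summable sequences are closed under \<open>x \<mapsto> - x\<close>, so adding and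
  subtracting the conditions for \<open>x\<close> and \<open>- x\<close> separates the two parts: \<open>P\<close> is summing at \<open>a\<close> iff
  both \<open>P\<close> and \<open>dhat a\<close> map every such sequence into \<open>ell p\<close> (\<open>summing_at_poly2_iff\<close>). The
  condition on \<open>P\<close> does not involve \<open>a\<close>. Hence, if it holds at one point, only the condition on
  \<open>dhat a\<close> distinguishes the points of the space.

  What remains is to see that a continuous linear operator \<open>u\<close> is summing as soon as it sends
  unconditionally summable sequences, rather than all weakly summable ones, into \<open>ell p\<close>
  (\<open>summing_operator_iff_ell_u\<close>). If \<open>x\<close> is weakly summable and \<open>\<Sum> \<parallel>u (x j)\<parallel> powr p\<close> diverges,
  then by a theorem of Abel and Dini the terms can be multiplied by a null sequence without losing
  divergence. Multiplying \<open>x\<close> by the \<open>p\<close>-th roots of these factors gives a sequence that \<open>u\<close> still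
  does not send into \<open>ell p\<close>, but that is unconditionally summable, since the tails of the null
  sequence bound the weak norms of its tails. This last point rests on the finiteness of
  the weak norm of \<open>x\<close>, a uniform boundedness principle on the dual (\<open>ell_w_bounded\<close>).

  The subspace property is the linearity of \<open>dhat a x\<close> in \<open>a\<close>. For scalar \<open>P\<close> each \<open>dhat a\<close> is a
  functional, which maps \<open>ell_w q\<close> into \<open>ell q \<subseteq> ell p\<close> by the definition of weak summability.
\<close>

section \<open>The sequence spaces\<close>

text \<open>
  A crude substitute for Minkowski's inequality: since only convergence and boundedness matter, the
  constant is irrelevant.
\<close>

lemma norm_add_powr_le:
  fixes a b :: "'a::real_normed_vector"
  assumes "0 \<le> p"
  shows "norm (a + b) powr p \<le> 2 powr p * (norm a powr p + norm b powr p)"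
proof -
  have "norm (a + b) \<le> 2 * max (norm a) (norm b)"
    using norm_triangle_ineq[of a b] by linarith
  then have "norm (a + b) powr p \<le> (2 * max (norm a) (norm b)) powr p"
    using assms by (intro powr_mono2) auto
  also have "\<dots> = 2 powr p * max (norm a) (norm b) powr p"
    by (simp add: powr_mult)
  also have "\<dots> \<le> 2 powr p * (norm a powr p + norm b powr p)"
    by (intro mult_left_mono) (auto simp: max_def)
  finally show ?thesis .
qed

lemma ell_add:
  assumes "0 \<le> p" "y \<in> ell p" "z \<in> ell p"
  shows "(\<lambda>j. y j + z j) \<in> ell p"
proof -
  have "summable (\<lambda>j. 2 powr p * (norm (y j) powr p + norm (z j) powr p))"
    using assms by (intro summable_mult summable_add) (auto simp: ell_def)
  then have "summable (\<lambda>j. norm (y j + z j) powr p)"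
    by (rule summable_comparison_test'[where N = 0]) (simp add: norm_add_powr_le assms(1))
  then show ?thesis by (simp add: ell_def)
qed

lemma ell_cmult_norm:
  assumes "y \<in> ell p" "\<And>j. norm (z j) = c * norm (y j)" "0 \<le> c"
  shows "z \<in> ell p"
  using assms by (auto simp: ell_def powr_mult intro!: summable_mult)

lemma zero_in_ell: "(\<lambda>_. 0) \<in> ell p"
  by (simp add: ell_def)

lemma ell_mono:
  assumes "1 \<le> q" "q \<le> p"
  shows "ell q \<subseteq> ell p"
proof
  \<comment> \<open>The terms are eventually at most \<open>1\<close>, where a larger exponent gives a smaller power.\<close>
  fix y :: "nat \<Rightarrow> 'a" assume y: "y \<in> ell q"
  then have "(\<lambda>j. norm (y j) powr q) \<longlonglongrightarrow> 0"
    by (auto simp: ell_def intro: summable_LIMSEQ_zero)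
  then have "\<forall>\<^sub>F j in sequentially. norm (y j) powr q < 1"
    by (rule order_tendstoD) simp
  then have "\<forall>\<^sub>F j in sequentially. norm (norm (y j) powr p) \<le> norm (y j) powr q"
  proof eventually_elim
    case (elim j)
    have "norm (y j) \<le> 1"
      using elim assms(1) ge_one_powr_ge_zero[of "norm (y j)" q] by force
    then show ?case using assms by (simp add: powr_mono')
  qed
  then show "y \<in> ell p"
    using y unfolding ell_def by (auto intro: summable_comparison_test_ev)
qed

section \<open>Continuous linear operators over the scalar field\<close>

lemma continuous_linear_imp_bounded_linear:
  assumes E: "banach_space_over sE" and F: "banach_space_over sF"
    and u: "continuous_linear sE sF u"
  shows "bounded_linear u"
proof -
  interpret E: banach_space_over sE by fact
  interpret F: banach_space_over sF by fact
  have lin: "Vector_Spaces.linear sE sF u" and cont: "continuous_on UNIV u"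
    using u by (auto simp: continuous_linear_def)
  interpret u: Vector_Spaces.linear sE sF u by fact
  have scaleR: "u (r *\<^sub>R x) = r *\<^sub>R u x" for r x
    by (metis E.scale_of_real F.scale_of_real u.scale)
  have "isCont u 0"
    using cont by (simp add: continuous_on_eq_continuous_at)
  then obtain d where d: "d > 0" "\<And>x. dist x 0 < d \<Longrightarrow> dist (u x) (u 0) < 1"
    by (metis continuous_at_eps_delta zero_less_one)
  have "norm (u x) \<le> norm x * (2 / d)" for x
  proof (cases "x = 0")
    case False
    then have "norm (u ((d / (2 * norm x)) *\<^sub>R x)) < 1"
      using d(1) d(2)[of "(d / (2 * norm x)) *\<^sub>R x"] by (simp add: u.zero)
    then show ?thesis
      using False d(1) by (simp add: scaleR field_simps)
  qed (simp add: u.zero)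
  then show ?thesis
    by (intro bounded_linear_intro[where K = "2 / d"] u.add scaleR)
qed

lemma zero_in_dual:
  assumes "banach_space_over sE"
  shows "(\<lambda>_. 0) \<in> dual sE"
proof -
  interpret E: banach_space_over sE by fact
  show ?thesis
    by (simp add: dual_def continuous_linear_def Vector_Spaces.linear_iff
        E.vector_space_axioms banach_space_over.axioms(1)[OF banach_space_over_times])
qed

lemma dual_scaleR:
  assumes "banach_space_over sE" "\<phi> \<in> dual sE"
  shows "\<phi> (r *\<^sub>R x) = r *\<^sub>R \<phi> x"
  using continuous_linear_imp_bounded_linear[OF assms(1) banach_space_over_times] assms(2)
  by (simp add: dual_def bounded_linear.linear linear_scale)

section \<open>Weakly summable sequences are bounded on the dual ball\<close>

text \<open>
  The continuous functionals form a closed subspace \<open>D\<close> of the Banach space of bounded real-linear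
  maps into the scalars, so Baire's theorem applies to \<open>D\<close>. The closed sets on which the partial
  sums are uniformly bounded by \<open>m\<close> exhaust \<open>D\<close>; one of them contains a ball, and translating and
  scaling that ball carries the bound to the unit ball.
\<close>

lemma ell_w_bounded:
  fixes sE :: "'k::real_or_complex \<Rightarrow> 'e::banach \<Rightarrow> 'e"
  assumes E: "banach_space_over sE" and q: "1 \<le> q" and x: "x \<in> ell_w sE q"
  obtains C where "0 \<le> C"
    "\<And>\<phi>. \<phi> \<in> dual sE \<Longrightarrow> onorm \<phi> \<le> 1 \<Longrightarrow> (\<Sum>j. norm (\<phi> (x j)) powr q) \<le> C"
proof -
  interpret E: banach_space_over sE by fact
  define D :: "('e \<Rightarrow>\<^sub>L 'k) set" where "D = {f. \<forall>c v. blinfun_apply f (sE c v) = c * blinfun_apply f v}"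
  define T where "T m = {f\<in>D. \<forall>N. (\<Sum>j<N. norm (blinfun_apply f (x j)) powr q) \<le> real m}" for m
  have D_dual: "blinfun_apply f \<in> dual sE" if "f \<in> D" for f
    using that
    by (auto simp: D_def dual_def continuous_linear_def Vector_Spaces.linear_iff
        E.vector_space_axioms banach_space_over.axioms(1)[OF banach_space_over_times] blinfun.add_right intro!: continuous_intros)
  have summable: "summable (\<lambda>j. norm (\<phi> (x j)) powr q)" if "\<phi> \<in> dual sE" for \<phi>
    using x that by (auto simp: ell_w_def ell_def)
  have "closed D"
    unfolding D_def by (intro closed_Collect_all closed_Collect_eq continuous_intros)
  have "closed (T m)" for m
  proof -
    have "T m = D \<inter> {f. \<forall>N. (\<Sum>j<N. norm (blinfun_apply f (x j)) powr q) \<le> real m}"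
      by (auto simp: T_def)
    moreover have "closed {f. \<forall>N. (\<Sum>j<N. norm (blinfun_apply f (x j)) powr q) \<le> real m}"
      using q by (intro closed_Collect_all closed_Collect_le continuous_intros
          continuous_on_powr') auto
    ultimately show ?thesis using \<open>closed D\<close> by auto
  qed
  moreover have "T m \<subseteq> D" for m by (auto simp: T_def)
  ultimately have closedin: "closedin (top_of_set D) (T m)" for m
    by (simp add: closed_subset)
  have union: "(\<Union>m. T m) = D"
  proof
    show "D \<subseteq> (\<Union>m. T m)"
    proof
      fix f assume f: "f \<in> D"
      obtain m where m: "(\<Sum>j. norm (blinfun_apply f (x j)) powr q) \<le> real m"
        using real_arch_simple by blast
      have "(\<Sum>j<N. norm (blinfun_apply f (x j)) powr q) \<le> real m" for N
        by (rule order_trans[OF sum_le_suminf m]) (auto intro: summable D_dual f)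
      then show "f \<in> (\<Union>m. T m)" using f by (auto simp: T_def)
    qed
  qed (auto simp: T_def)
  have "0 \<in> D" by (simp add: D_def)
  have "completely_metrizable_space (top_of_set D)"
    using \<open>closed D\<close>
    by (simp add: completely_metrizable_space_closedin completely_metrizable_space_euclidean)
  moreover have "top_of_set D interior_of (\<Union>(range T)) \<noteq> {}"
    using \<open>0 \<in> D\<close> union interior_of_topspace[of "top_of_set D"] by auto
  ultimately have "\<not> (\<forall>A\<in>range T. closedin (top_of_set D) A \<and> top_of_set D interior_of A = {})"
    using Baire_category_alt[of "top_of_set D" "range T"] by auto
  then obtain m where "top_of_set D interior_of T m \<noteq> {}"
    using closedin by auto
  then obtain U f0 where U: "openin (top_of_set D) U" "U \<subseteq> T m" "f0 \<in> U"
    by (auto simp: interior_of_def)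
  then obtain e where e: "e > 0" "\<And>f. f \<in> D \<Longrightarrow> dist f f0 < e \<Longrightarrow> f \<in> T m"
    by (metis openin_euclidean_subtopology_iff subsetD)
  have f0: "f0 \<in> D" "f0 \<in> T m" using U by (auto simp: T_def)
  define r where "r = e / 2"
  have r: "0 < r" "r < e" using e by (auto simp: r_def)
  define C where "C = (2 * real m) * 2 powr q / r powr q"
  show ?thesis
  proof
    show "0 \<le> C" by (simp add: C_def)
    fix \<phi> assume \<phi>: "\<phi> \<in> dual sE" "onorm \<phi> \<le> 1"
    have bl: "bounded_linear \<phi>"
      using continuous_linear_imp_bounded_linear[OF E banach_space_over_times] \<phi>(1)
      by (simp add: dual_def)
    define g where "g = Blinfun \<phi>"
    have g: "blinfun_apply g = \<phi>" unfolding g_def by (rule bounded_linear_Blinfun_apply[OF bl])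
    have "norm g \<le> 1" using \<phi>(2) by (simp add: norm_blinfun.rep_eq g)
    have "g \<in> D"
      using \<phi>(1) by (auto simp: D_def g dual_def continuous_linear_def Vector_Spaces.linear_iff)
    \<comment> \<open>\<open>r *\<^sub>R g\<close> is a difference of two points of the ball on which the bound \<open>m\<close> holds.\<close>
    define f1 where "f1 = f0 + r *\<^sub>R g"
    have "f1 \<in> D"
      using f0(1) \<open>g \<in> D\<close>
      by (auto simp: D_def f1_def blinfun.add_left blinfun.scaleR_left algebra_simps)
    moreover have "dist f1 f0 < e"
    proof -
      have "dist f1 f0 = r * norm g" using r by (simp add: f1_def dist_norm)
      also have "\<dots> \<le> r * 1" using r \<open>norm g \<le> 1\<close> by (intro mult_left_mono) auto
      finally show ?thesis using r by simp
    qed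
    ultimately have f1: "f1 \<in> T m" by (rule e(2))
    have "(\<Sum>j<N. norm (\<phi> (x j)) powr q) \<le> C" for N
    proof -
      have "r powr q * norm (\<phi> (x j)) powr q
          \<le> 2 powr q * (norm (f1 (x j)) powr q + norm (f0 (x j)) powr q)" for j
      proof -
        have "r *\<^sub>R \<phi> (x j) = f1 (x j) + - f0 (x j)"
          by (simp add: f1_def blinfun.add_left blinfun.scaleR_left g)
        then have "norm (r *\<^sub>R \<phi> (x j)) powr q
            \<le> 2 powr q * (norm (f1 (x j)) powr q + norm (f0 (x j)) powr q)"
          using norm_add_powr_le[of q "f1 (x j)" "- f0 (x j)"] q by simp
        then show ?thesis using r by (simp add: powr_mult)
      qed
      then have "(\<Sum>j<N. r powr q * norm (\<phi> (x j)) powr q)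
          \<le> (\<Sum>j<N. 2 powr q * (norm (f1 (x j)) powr q + norm (f0 (x j)) powr q))"
        by (rule sum_mono)
      also have "\<dots> = 2 powr q * ((\<Sum>j<N. norm (f1 (x j)) powr q) + (\<Sum>j<N. norm (f0 (x j)) powr q))"
        by (simp only: sum.distrib flip: sum_distrib_left)
      also have "\<dots> \<le> 2 powr q * (real m + real m)"
        using f0(2) f1 by (intro mult_left_mono add_mono) (auto simp: T_def)
      finally show ?thesis
        using r by (simp add: C_def sum_distrib_left[symmetric] field_simps)
    qed
    then show "(\<Sum>j. norm (\<phi> (x j)) powr q) \<le> C"
      by (intro suminf_le_const summable \<phi>(1))
  qed
qed

section \<open>Testing summability on unconditionally summable sequences\<close>

text \<open>
  This is the Abel--Dini theorem: dividing each term of a divergent series by the partial sum up to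
  that term preserves divergence. The block from \<open>m\<close> to \<open>n\<close> of the new series is at least
  \<open>(S n - S m) / S n\<close>, which tends to \<open>1\<close> as \<open>n\<close> grows, contradicting the Cauchy criterion.
\<close>

lemma divergent_series_null_multiplier:
  fixes c :: "nat \<Rightarrow> real"
  assumes c: "\<And>j. 0 \<le> c j" and div: "\<not> summable c"
  obtains m where "\<And>j. 0 < m j" "\<And>j. m j \<le> 1" "m \<longlonglongrightarrow> 0" "\<not> summable (\<lambda>j. m j * c j)"
proof -
  \<comment> \<open>The summand \<open>1\<close> makes the factors \<open>1 / S\<close> well defined and at most \<open>1\<close>.\<close>
  define S where "S n = 1 + (\<Sum>i<n. c i)" for n
  have mono: "S m \<le> S n" if "m \<le> n" for m n
    unfolding S_def using that c by (auto intro!: sum_mono2)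
  have S1: "1 \<le> S n" for n
    using mono[of 0 n] by (simp add: S_def)
  have lim: "filterlim S at_top sequentially"
  proof -
    have "\<exists>n. K \<le> S n" for K
    proof (rule ccontr)
      assume "\<nexists>n. K \<le> S n"
      then have "(\<Sum>i<n. c i) \<le> K" for n
        by (auto simp: S_def not_le intro: less_imp_le dest: spec[of _ n])
      then have "summable c"
        using c by (intro summableI_nonneg_bounded) auto
      then show False using div by simp
    qed
    then show ?thesis
      unfolding filterlim_at_top eventually_sequentially by (meson mono order_trans)
  qed
  show ?thesis
  proof
    show "0 < inverse (S (Suc j))" "inverse (S (Suc j)) \<le> 1" for j
      using S1[of "Suc j"] by (auto simp: inverse_le_1_iff)
    show "(\<lambda>j. inverse (S (Suc j))) \<longlonglongrightarrow> 0"
      by (rule LIMSEQ_Suc[OF tendsto_inverse_0_at_top[OF lim]])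
    show "\<not> summable (\<lambda>j. inverse (S (Suc j)) * c j)"
    proof
      assume "summable (\<lambda>j. inverse (S (Suc j)) * c j)"
      then obtain m where m: "\<And>n. norm (\<Sum>j=m..<n. inverse (S (Suc j)) * c j) < 1/2"
        unfolding summable_Cauchy by (metis half_gt_zero zero_less_one order_refl)
      obtain n where n: "2 * S m \<le> S n"
        using lim by (auto simp: filterlim_at_top eventually_sequentially)
      have "m \<le> n" using n mono[of n m] S1[of m] by (cases "m \<le> n") auto
      have "1/2 \<le> (S n - S m) * inverse (S n)"
        using n S1[of n] by (simp add: field_simps)
      also have "S n - S m = (\<Sum>j=m..<n. c j)"
        using \<open>m \<le> n\<close> by (simp add: S_def sum_diff_nat_ivl lessThan_atLeast0
            flip: sum.atLeastLessThan_concat[OF _ \<open>m \<le> n\<close>, of 0])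
      also have "\<dots> * inverse (S n) \<le> (\<Sum>j=m..<n. inverse (S (Suc j)) * c j)"
        unfolding sum_distrib_right
      proof (rule sum_mono)
        fix j assume "j \<in> {m..<n}"
        then have "inverse (S n) \<le> inverse (S (Suc j))"
          using mono[of "Suc j" n] S1[of "Suc j"] by (intro le_imp_inverse_le) auto
        then show "c j * inverse (S n) \<le> inverse (S (Suc j)) * c j"
          using c[of j] by (metis mult.commute mult_left_mono)
      qed
      finally show False using m[of n] by simp
    qed
  qed
qed

text \<open>
  Nonnegativity is not automatic: the supremum of an unbounded set of reals is unspecified, so both
  claims depend on the bound \<open>B\<close>.
\<close>

lemma norm_w_le:
  assumes E: "banach_space_over sE"
    and B: "\<And>\<phi>. \<phi> \<in> dual sE \<Longrightarrow> onorm \<phi> \<le> 1 \<Longrightarrow>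
      (\<Sum>j. norm (\<phi> (x j)) powr q) powr (1 / q) \<le> B"
  shows "0 \<le> norm_w sE q x" "norm_w sE q x \<le> B"
proof -
  let ?I = "{\<phi> \<in> dual sE. onorm \<phi> \<le> 1}"
  have 0: "(\<lambda>_. 0) \<in> ?I"
    using zero_in_dual[OF E] by (simp add: onorm_zero)
  then show "norm_w sE q x \<le> B"
    unfolding norm_w_def by (intro cSUP_least) (use B in auto)
  have "bdd_above ((\<lambda>\<phi>. (\<Sum>j. norm (\<phi> (x j)) powr q) powr (1 / q)) ` ?I)"
    by (intro bdd_aboveI2[of _ _ B]) (use B in auto)
  from cSUP_upper[OF 0 this] show "0 \<le> norm_w sE q x"
    by (simp add: norm_w_def)
qed

text \<open>
  If the factors are at most \<open>e\<close> from index \<open>k\<close> on, then the weak norm of the tail of the multiplied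
  sequence is at most \<open>e\<close> times the finite weak norm of \<open>x\<close>.
\<close>

lemma null_multiple_in_ell_u:
  fixes sE :: "'k::real_or_complex \<Rightarrow> 'e::banach \<Rightarrow> 'e"
  assumes E: "banach_space_over sE" and q: "1 \<le> q" and x: "x \<in> ell_w sE q"
    and m: "\<And>j. 0 < m j" "\<And>j. m j \<le> 1" "m \<longlonglongrightarrow> 0"
  shows "(\<lambda>j. m j *\<^sub>R x j) \<in> ell_u sE q"
proof -
  obtain C where C: "0 \<le> C"
    "\<And>\<phi>. \<phi> \<in> dual sE \<Longrightarrow> onorm \<phi> \<le> 1 \<Longrightarrow> (\<Sum>j. norm (\<phi> (x j)) powr q) \<le> C"
    using ell_w_bounded[OF E q x] by blast
  have summable: "summable (\<lambda>j. norm (\<phi> (x j)) powr q)" if "\<phi> \<in> dual sE" for \<phi>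
    using x that by (auto simp: ell_w_def ell_def)
  have bound: "norm (\<phi> (m j *\<^sub>R x j)) powr q \<le> e powr q * norm (\<phi> (x j)) powr q"
    if "\<phi> \<in> dual sE" "m j \<le> e" for \<phi> j e
  proof -
    have "norm (\<phi> (m j *\<^sub>R x j)) \<le> e * norm (\<phi> (x j))"
      using that m(1)[of j] by (simp add: dual_scaleR[OF E] mult_right_mono)
    then have "norm (\<phi> (m j *\<^sub>R x j)) powr q \<le> (e * norm (\<phi> (x j))) powr q"
      using q by (intro powr_mono2) auto
    then show ?thesis using that m(1)[of j] by (simp add: powr_mult)
  qed
  have summable_m: "summable (\<lambda>j. norm (\<phi> (m j *\<^sub>R x j)) powr q)" if "\<phi> \<in> dual sE" for \<phi>
    using summable[OF that] bound[OF that m(2)]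
    by (auto intro: summable_comparison_test'[where N = 0])
  define B where "B = C powr (1 / q)"
  have "(\<lambda>k. norm_w sE q (\<lambda>j. m (k + j) *\<^sub>R x (k + j))) \<longlonglongrightarrow> 0"
  proof (rule LIMSEQ_I)
    fix r :: real assume "0 < r"
    \<comment> \<open>\<open>B + 1\<close> rather than \<open>B\<close>, since \<open>B\<close> may vanish.\<close>
    define e where "e = r / (2 * (B + 1))"
    have "0 \<le> B" by (simp add: B_def)
    have e: "0 < e" "e * B < r"
      using \<open>0 < r\<close> \<open>0 \<le> B\<close> by (auto simp: e_def field_simps add_strict_increasing2)
    obtain n where n: "\<And>k. k \<ge> n \<Longrightarrow> m k \<le> e"
      using order_tendstoD(2)[OF m(3) e(1)] unfolding eventually_sequentially
      by (meson less_imp_le)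
    have "norm (norm_w sE q (\<lambda>j. m (k + j) *\<^sub>R x (k + j)) - 0) < r" if "k \<ge> n" for k
    proof -
      have "(\<Sum>j. norm (\<phi> (m (k + j) *\<^sub>R x (k + j))) powr q) powr (1 / q) \<le> e * B"
        if \<phi>: "\<phi> \<in> dual sE" "onorm \<phi> \<le> 1" for \<phi>
      proof -
        have s: "summable (\<lambda>j. e powr q * norm (\<phi> (x (j + k))) powr q)"
          using summable[OF \<phi>(1)] by (intro summable_mult summable_ignore_initial_segment)
        have "(\<Sum>j. norm (\<phi> (m (k + j) *\<^sub>R x (k + j))) powr q)
            \<le> (\<Sum>j. e powr q * norm (\<phi> (x (j + k))) powr q)"
          using summable_ignore_initial_segment[OF summable_m[OF \<phi>(1)], of k] \<open>k \<ge> n\<close>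
          by (intro suminf_le s) (auto simp: add.commute intro!: bound \<phi> n)
        also have "\<dots> = e powr q * (\<Sum>j. norm (\<phi> (x (j + k))) powr q)"
          by (intro suminf_mult summable_ignore_initial_segment summable \<phi>)
        also have "(\<Sum>j. norm (\<phi> (x (j + k))) powr q) \<le> (\<Sum>j. norm (\<phi> (x j)) powr q)"
          using suminf_split_initial_segment[OF summable[OF \<phi>(1)], of k]
          by (simp add: sum_nonneg)
        also have "\<dots> \<le> C" by (rule C(2)[OF \<phi>])
        finally have "(\<Sum>j. norm (\<phi> (m (k + j) *\<^sub>R x (k + j))) powr q) \<le> e powr q * C"
          by (simp add: mult_left_mono)
        moreover have "0 \<le> (\<Sum>j. norm (\<phi> (m (k + j) *\<^sub>R x (k + j))) powr q)"
          using summable_ignore_initial_segment[OF summable_m[OF \<phi>(1)], of k]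
          by (intro suminf_nonneg) (auto simp: add.commute)
        ultimately have "(\<Sum>j. norm (\<phi> (m (k + j) *\<^sub>R x (k + j))) powr q) powr (1 / q)
            \<le> (e powr q * C) powr (1 / q)"
          using q by (intro powr_mono2) auto
        also have "\<dots> = e * B"
          using q e C(1) by (simp add: powr_mult powr_powr B_def)
        finally show ?thesis .
      qed
      then have "0 \<le> norm_w sE q (\<lambda>j. m (k + j) *\<^sub>R x (k + j))"
        "norm_w sE q (\<lambda>j. m (k + j) *\<^sub>R x (k + j)) \<le> e * B"
        using norm_w_le[OF E, of "\<lambda>j. m (k + j) *\<^sub>R x (k + j)" q "e * B"] by blast+
      then show ?thesis using e(2) by simp
    qed
    then show "\<exists>no. \<forall>k\<ge>no. norm (norm_w sE q (\<lambda>j. m (k + j) *\<^sub>R x (k + j)) - 0) < r"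
      by blast
  qed
  then show ?thesis
    using summable_m by (auto simp: ell_u_def ell_w_def ell_def)
qed

text \<open>
  Multipliers that keep \<open>\<Sum> \<parallel>u (x j)\<parallel> powr p\<close> divergent while tending to zero turn a weakly summable
  counterexample into an unconditionally summable one.
\<close>

lemma summing_operator_iff_ell_u:
  assumes E: "banach_space_over sE" and F: "banach_space_over sF"
    and q: "1 \<le> q" and p: "0 < p" and u: "continuous_linear sE sF u"
  shows "summing_operator sE sF p q u \<longleftrightarrow> (\<forall>x\<in>ell_u sE q. (\<lambda>j. u (x j)) \<in> ell p)"
proof
  assume "summing_operator sE sF p q u"
  then show "\<forall>x\<in>ell_u sE q. (\<lambda>j. u (x j)) \<in> ell p"
    by (auto simp: summing_operator_def ell_u_def)
next
  assume *: "\<forall>x\<in>ell_u sE q. (\<lambda>j. u (x j)) \<in> ell p"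
  have "(\<lambda>j. u (x j)) \<in> ell p" if x: "x \<in> ell_w sE q" for x
  proof (rule ccontr)
    assume "(\<lambda>j. u (x j)) \<notin> ell p"
    then have "\<not> summable (\<lambda>j. norm (u (x j)) powr p)" by (simp add: ell_def)
    from divergent_series_null_multiplier[OF _ this]
    obtain m where m: "\<And>j. 0 < m j" "\<And>j. m j \<le> 1" "m \<longlonglongrightarrow> 0"
      "\<not> summable (\<lambda>j. m j * norm (u (x j)) powr p)" by auto
    \<comment> \<open>The root undoes the power \<open>p\<close> that the norm of the multiplied sequence is raised to.\<close>
    define l where "l j = m j powr (1 / p)" for j
    have "(\<lambda>j. l j *\<^sub>R x j) \<in> ell_u sE q"
    proof (rule null_multiple_in_ell_u[OF E q x])
      show "0 < l j" "l j \<le> 1" for j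
        using m(1,2)[of j] p by (auto simp: l_def intro: powr_le1 less_imp_le)
      show "l \<longlonglongrightarrow> 0"
        unfolding l_def using m(1,3) p by (intro tendsto_zero_powrI[where b = "1 / p"]) (auto simp: less_imp_le)
    qed
    then have "summable (\<lambda>j. norm (u (l j *\<^sub>R x j)) powr p)"
      using * by (auto simp: ell_def)
    moreover have "norm (u (l j *\<^sub>R x j)) powr p = m j * norm (u (x j)) powr p" for j
      using continuous_linear_imp_bounded_linear[OF E F u] m(1)[of j] p
      by (simp add: bounded_linear.linear linear_scale powr_mult l_def powr_powr)
    ultimately show False using m(4) by simp
  qed
  then show "summing_operator sE sF p q u"
    using u by (simp add: summing_operator_def)
qed

section \<open>Quadratic polynomials\<close>

lemma polar_properties:
  assumes "P \<in> poly2 sE sF"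
  shows "bilinear_over sE sF (polar sE sF P)"
    and "polar sE sF P x y = polar sE sF P y x"
    and "P x = polar sE sF P x x"
  using theI'[OF polar_ex1[OF assms]] unfolding polar_def by blast+

lemma poly2_add:
  assumes F: "banach_space_over sF" and P: "P \<in> poly2 sE sF"
  shows "P (a + x) = P a + dhat sE sF P a x + P x"
proof -
  interpret F: banach_space_over sF by fact
  note A = polar_properties[OF P]
  have l: "Vector_Spaces.linear sE sF (\<lambda>y. polar sE sF P z y)"
    "Vector_Spaces.linear sE sF (\<lambda>y. polar sE sF P y z)" for z
    using A(1) by (auto simp: bilinear_over_def)
  then have "polar sE sF P (a + x) (a + x) = polar sE sF P a a + polar sE sF P x a
      + (polar sE sF P a x + polar sE sF P x x)"
    by (simp add: Vector_Spaces.linear_iff)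
  moreover have "sF 2 v = v + v" for v
    using F.scale_left_distrib[of 1 1 v] by simp
  ultimately show ?thesis
    using A(2)[of x a] A(3)[of a] A(3)[of x] A(3)[of "a + x"] by (simp add: dhat_def)
qed

lemma poly2_minus:
  assumes "P \<in> poly2 sE sF"
  shows "P (- x) = P x"
proof -
  have "Vector_Spaces.linear sE sF (\<lambda>y. polar sE sF P z y)"
    "Vector_Spaces.linear sE sF (\<lambda>y. polar sE sF P y z)" for z
    using polar_properties(1)[OF assms] by (auto simp: bilinear_over_def)
  then interpret l: Vector_Spaces.linear sE sF "\<lambda>y. polar sE sF P z y"
    + r: Vector_Spaces.linear sE sF "\<lambda>y. polar sE sF P y z" for z
    by auto
  show ?thesis
    by (simp add: polar_properties(3)[OF assms] l.neg r.neg)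
qed

lemma dhat_linear:
  assumes F: "banach_space_over sF" and P: "P \<in> poly2 sE sF"
  shows "Vector_Spaces.linear sE sF (dhat sE sF P a)"
    and "Vector_Spaces.linear sE sF (\<lambda>a. dhat sE sF P a x)"
proof -
  interpret F: banach_space_over sF by fact
  have l: "Vector_Spaces.linear sE sF (\<lambda>y. polar sE sF P z y)"
    "Vector_Spaces.linear sE sF (\<lambda>y. polar sE sF P y z)" for z
    using polar_properties(1)[OF P] by (auto simp: bilinear_over_def)
  then interpret vector_space_pair sE sF
    by (auto simp: Vector_Spaces.linear_def vector_space_pair_def)
  show "Vector_Spaces.linear sE sF (dhat sE sF P a)"
    and "Vector_Spaces.linear sE sF (\<lambda>a. dhat sE sF P a x)"
    unfolding dhat_def by (intro linear_compose_scale_right l)+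
qed

text \<open>
  Membership of \<open>P\<close> in \<^const>\<open>poly2\<close> provides a continuous bilinear map, but not necessarily the
  symmetric one. Continuity is therefore read off from \<open>dhat a x = P (a + x) - P a - P x\<close>.
\<close>

lemma dhat_continuous_linear:
  assumes F: "banach_space_over sF" and P: "P \<in> poly2 sE sF"
  shows "continuous_linear sE sF (dhat sE sF P a)"
proof -
  obtain A where A: "continuous_on UNIV (\<lambda>(x, y). A x y)" "\<And>x. P x = A x x"
    using P by (auto simp: poly2_def)
  have "continuous_on UNIV (\<lambda>z. (\<lambda>(x, y). A x y) (z, z))"
    by (rule continuous_on_compose2[OF A(1)]) (auto intro!: continuous_intros)
  then have P_cont: "continuous_on UNIV P"
    using A(2) by (simp cong: continuous_on_cong)
  have "dhat sE sF P a = (\<lambda>x. P (a + x) - P a - P x)"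
    using poly2_add[OF F P] by auto
  moreover have "continuous_on UNIV (\<lambda>x. P (a + x) - P a - P x)"
    by (intro continuous_intros continuous_on_compose2[OF P_cont]) auto
  ultimately show ?thesis
    using dhat_linear(1)[OF F P, of a] by (auto simp only: continuous_linear_def)
qed

lemma ell_u_minus:
  assumes E: "banach_space_over sE" and x: "x \<in> ell_u sE q"
  shows "(\<lambda>j. - x j) \<in> ell_u sE q"
proof -
  have neg: "norm (\<phi> (- v)) = norm (\<phi> v)" if "\<phi> \<in> dual sE" for \<phi> v
    using dual_scaleR[OF E that, of "-1" v] by simp
  then have "norm_w sE q (\<lambda>j. - x (k + j)) = norm_w sE q (\<lambda>j. x (k + j))" for k
    unfolding norm_w_def by (intro SUP_cong) auto
  with x neg show ?thesis
    by (auto simp: ell_u_def ell_w_def ell_def)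
qed

text \<open>
  Testing with \<open>x\<close> and with \<open>- x\<close> separates the odd part \<open>dhat a\<close> of the increment of \<open>P\<close> at \<open>a\<close>
  from its even part \<open>P\<close>.
\<close>

lemma summing_at_poly2_iff:
  assumes E: "banach_space_over sE" and F: "banach_space_over sF"
    and p: "0 \<le> p" and P: "P \<in> poly2 sE sF"
  shows "summing_at sE p q P a \<longleftrightarrow>
    (\<forall>x\<in>ell_u sE q. (\<lambda>j. P (x j)) \<in> ell p \<and> (\<lambda>j. dhat sE sF P a (x j)) \<in> ell p)"
proof
  have diff: "P (a + v) - P a = dhat sE sF P a v + P v" for v
    by (simp add: poly2_add[OF F P])
  assume a: "summing_at sE p q P a"
  show "\<forall>x\<in>ell_u sE q. (\<lambda>j. P (x j)) \<in> ell p \<and> (\<lambda>j. dhat sE sF P a (x j)) \<in> ell p"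
  proof
    fix x assume x: "x \<in> ell_u sE q"
    interpret d: Vector_Spaces.linear sE sF "dhat sE sF P a"
      by (rule dhat_linear(1)[OF F P])
    have plus: "(\<lambda>j. dhat sE sF P a (x j) + P (x j)) \<in> ell p"
      using a x unfolding summing_at_def diff by blast
    have "(\<lambda>j. dhat sE sF P a (- x j) + P (- x j)) \<in> ell p"
      using a[unfolded summing_at_def diff] ell_u_minus[OF E x] by auto
    then have minus: "(\<lambda>j. - dhat sE sF P a (x j) + P (x j)) \<in> ell p"
      by (simp add: poly2_minus[OF P] d.neg)
    have "(\<lambda>j. P (x j)) \<in> ell p"
      by (rule ell_cmult_norm[OF ell_add[OF p plus minus], of _ "1/2"])
        (simp_all flip: scaleR_2)
    moreover have "(\<lambda>j. - P (x j)) \<in> ell p"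
      using calculation by (simp add: ell_def)
    from ell_add[OF p plus this] have "(\<lambda>j. dhat sE sF P a (x j)) \<in> ell p"
      by simp
    ultimately show "(\<lambda>j. P (x j)) \<in> ell p \<and> (\<lambda>j. dhat sE sF P a (x j)) \<in> ell p" ..
  qed
next
  assume "\<forall>x\<in>ell_u sE q. (\<lambda>j. P (x j)) \<in> ell p \<and> (\<lambda>j. dhat sE sF P a (x j)) \<in> ell p"
  then have "(\<lambda>j. dhat sE sF P a (x j) + P (x j)) \<in> ell p" if "x \<in> ell_u sE q" for x
    using that by (intro ell_add p) auto
  then show "summing_at sE p q P a"
    by (simp add: summing_at_def poly2_add[OF F P])
qed

text \<open>
  Being summing at one point already yields the condition on \<open>P\<close> that all points share.
\<close>

lemma summing_set_poly2:
  assumes E: "banach_space_over sE" and F: "banach_space_over sF"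
    and q: "1 \<le> q" and p: "0 < p" and P: "P \<in> poly2 sE sF"
    and ne: "summing_set sE p q P \<noteq> {}"
  shows "summing_set sE p q P = {a. summing_operator sE sF p q (dhat sE sF P a)}"
proof -
  have "\<forall>x\<in>ell_u sE q. (\<lambda>j. P (x j)) \<in> ell p"
    using ne p by (auto simp: summing_set_def summing_at_poly2_iff[OF E F _ P])
  then show ?thesis
    using p by (auto simp: summing_set_def summing_at_poly2_iff[OF E F _ P]
        summing_operator_iff_ell_u[OF E F q p dhat_continuous_linear[OF F P]])
qed

lemma subspace_summing_differentials:
  assumes E: "banach_space_over sE" and F: "banach_space_over sF"
    and p: "0 \<le> p" and P: "P \<in> poly2 sE sF"
  shows "module.subspace sE {a. summing_operator sE sF p q (dhat sE sF P a)}"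
proof -
  interpret E: banach_space_over sE by fact
  interpret F: banach_space_over sF by fact
  interpret d: Vector_Spaces.linear sE sF "\<lambda>a. dhat sE sF P a x" for x
    by (rule dhat_linear(2)[OF F P])
  let ?d = "dhat sE sF P"
  have mem: "summing_operator sE sF p q (?d a) \<longleftrightarrow> (\<forall>x\<in>ell_w sE q. (\<lambda>j. ?d a (x j)) \<in> ell p)" for a
    by (simp add: summing_operator_def dhat_continuous_linear[OF F P])
  show ?thesis
  proof (rule E.subspaceI; simp only: mem mem_Collect_eq)
    show "\<forall>x\<in>ell_w sE q. (\<lambda>j. ?d 0 (x j)) \<in> ell p"
      by (simp add: d.zero zero_in_ell)
    show "\<forall>x\<in>ell_w sE q. (\<lambda>j. ?d (a + b) (x j)) \<in> ell p"
      if "\<forall>x\<in>ell_w sE q. (\<lambda>j. ?d a (x j)) \<in> ell p"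
        "\<forall>x\<in>ell_w sE q. (\<lambda>j. ?d b (x j)) \<in> ell p" for a b
      using that by (simp add: d.add ell_add[OF p])
    show "\<forall>x\<in>ell_w sE q. (\<lambda>j. ?d (sE c a) (x j)) \<in> ell p"
      if "\<forall>x\<in>ell_w sE q. (\<lambda>j. ?d a (x j)) \<in> ell p" for c a
      using that by (auto simp: d.scale F.norm_scale intro: ell_cmult_norm[where c = "norm c"])
  qed
qed

theorem theorem4p1:
  fixes sE :: "'k::real_or_complex \<Rightarrow> 'e::banach \<Rightarrow> 'e"
    and sF :: "'k \<Rightarrow> 'f::banach \<Rightarrow> 'f"
    and p q :: real
  assumes "banach_space_over sE"
    and "banach_space_over sF"
    and "1 \<le> q" and "q \<le> p"
  shows "(\<forall>P\<in>poly2 sE sF.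
            (summing_set sE p q P = {} \<or>
             summing_set sE p q P = {a. summing_operator sE sF p q (dhat sE sF P a)}) \<and>
            (summing_set sE p q P = {} \<or>
             module.subspace sE (summing_set sE p q P))) \<and>
         (\<forall>P\<in>poly2 sE (times :: 'k \<Rightarrow> 'k \<Rightarrow> 'k).
            summing_set sE p q P = {} \<or> summing_set sE p q P = UNIV)"
proof -
  note E = assms(1) and F = assms(2) and q = assms(3)
  note K = banach_space_over_times[where 'k = 'k]
  have p: "0 < p" "0 \<le> p" using assms(3,4) by auto
  have "summing_operator sE times p q (dhat sE times P a)"
    if P: "P \<in> poly2 sE (times :: 'k \<Rightarrow> 'k \<Rightarrow> 'k)" for P a
    using dhat_continuous_linear[OF K P, of a] ell_mono[OF assms(3,4)]
    by (auto simp: summing_operator_def ell_w_def dual_def)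
  then have scalar: "{a. summing_operator sE times p q (dhat sE times P a)} = UNIV"
    if "P \<in> poly2 sE (times :: 'k \<Rightarrow> 'k \<Rightarrow> 'k)" for P
    using that by blast
  show ?thesis
  proof (intro conjI ballI)
    fix P assume P: "P \<in> poly2 sE sF"
    show 1: "summing_set sE p q P = {} \<or>
        summing_set sE p q P = {a. summing_operator sE sF p q (dhat sE sF P a)}"
      using summing_set_poly2[OF E F q p(1) P] by blast
    show "summing_set sE p q P = {} \<or> module.subspace sE (summing_set sE p q P)"
      using 1 subspace_summing_differentials[OF E F p(2) P, of q] by metis
  next
    fix P assume P: "P \<in> poly2 sE (times :: 'k \<Rightarrow> 'k \<Rightarrow> 'k)"
    show "summing_set sE p q P = {} \<or> summing_set sE p q P = UNIV"
      using summing_set_poly2[OF E K q p(1) P] scalar[OF P] by blast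
  qed
qed

end
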